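(* Let $f:\mathbb{R}^n\to\mathbb{R}$ be a convex function with global minimum point $x^*$ which has an $L$-continuous gradient ($L>0$) and is $\mu$-strong convex ($\mu>0$). Let $\lambda>0$ and $\rho>0$, and consider the gradient method $$\begin{cases}\dot x = -\theta\,\dfrac{\nabla f(x)}{\|\nabla f(x)\|^2},\\[2mm] \dot\theta = -\lambda\theta+\rho\|\nabla f(x)\|^2,\end{cases}$$ where $\theta(t)$ is scalar-valued with $\theta(0)=0$. If $\lambda^2<\dfrac{8\rho\mu^2}{L}$, then for every initial condition $x(0)\in\mathbb{R}^n$ the trajectory $x(t)$ reaches the minimum point $x^*$ in a finite time. Moreover, the convergence time is no longer than $$\frac{\pi}{\sqrt{\dfrac{2\rho\mu^2}{L}-\dfrac{\lambda^2}{4}}}.$$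
   Context: $\|\cdot\|$ is the Euclidean norm and $\langle\cdot,\cdot\rangle$ the inner product on $\mathbb{R}^n$; dots denote derivatives with respect to time $t$. A function $f$ whose gradient exists is said to have an $L$-continuous gradient ($L>0$) if $\langle \nabla f(\theta_1)-\nabla f(\theta_2),\theta_1-\theta_2\rangle\le L\|\theta_1-\theta_2\|^2$ for all $\theta_1,\theta_2$ in the domain of $f$. A convex function $f$ whose gradient exists is said to be $\mu$-strong convex ($\mu>0$) if $\langle \nabla f(\theta_1)-\nabla f(\theta_2),\theta_1-\theta_2\rangle\ge \mu\|\theta_1-\theta_2\|^2$ for all $\theta_1,\theta_2$ in the domain of $f$. The right-hand side of the $x$-dynamics is undefined where $\nabla f(x)=0$; the trajectory is understood to be continuous and to satisfy the equations until it reaches the minimum point. The convergence time is the time at which $x(t)$ reaches $x^*$. *)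

theory Defs
  imports "HOL-Analysis.Analysis"
begin

definition has_gradient :: "('a::real_inner \<Rightarrow> real) \<Rightarrow> bool" where
  "has_gradient f \<longleftrightarrow> (\<forall>x. \<exists>D. GDERIV f x :> D)"

definition gradient :: "('a::real_inner \<Rightarrow> real) \<Rightarrow> 'a \<Rightarrow> 'a" where
  "gradient f x = (THE D. GDERIV f x :> D)"

lemma gradient_eqI:
  assumes "GDERIV f x :> D"
  shows "gradient f x = D"
  unfolding gradient_def
proof (rule the_equality)
  show "GDERIV f x :> D" by fact
next
  fix D' assume "GDERIV f x :> D'"
  then have "(\<lambda>h. h \<bullet> D') = (\<lambda>h. h \<bullet> D)"
    using assms unfolding gderiv_def by (rule has_derivative_unique)
  then have "(D' - D) \<bullet> D' = (D' - D) \<bullet> D" by metis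
  then have "(D' - D) \<bullet> (D' - D) = 0" by (simp add: inner_diff_right)
  then show "D' = D" by simp
qed

text \<open>This is a one-sided bound, weaker in general than Lipschitz continuity of the gradient.\<close>

definition L_continuous_gradient :: "real \<Rightarrow> ('a::real_inner \<Rightarrow> real) \<Rightarrow> bool" where
  "L_continuous_gradient L f \<longleftrightarrow> has_gradient f \<and>
     (\<forall>x y. (gradient f x - gradient f y) \<bullet> (x - y) \<le> L * (norm (x - y))\<^sup>2)"

definition strong_convex :: "real \<Rightarrow> ('a::real_inner \<Rightarrow> real) \<Rightarrow> bool" where
  "strong_convex \<mu> f \<longleftrightarrow> convex_on UNIV f \<and> has_gradient f \<and>
     (\<forall>x y. (gradient f x - gradient f y) \<bullet> (x - y) \<ge> \<mu> * (norm (x - y))\<^sup>2)"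

text \<open>The equations are imposed at time \<open>t\<close> only if \<open>x\<close> has not met \<open>xs\<close> during \<open>[0, t]\<close>:
  the right-hand side is undefined at \<open>xs\<close>, and after the first meeting nothing but continuity of
  \<open>x\<close> is required. Derivatives are taken within \<open>[0, \<infinity>)\<close>, hence are one-sided at time 0.\<close>

definition trajectory ::
  "('a::real_inner \<Rightarrow> real) \<Rightarrow> 'a \<Rightarrow> real \<Rightarrow> real \<Rightarrow> (real \<Rightarrow> 'a) \<Rightarrow> (real \<Rightarrow> real) \<Rightarrow> bool" where
  "trajectory f xs lam \<rho> x \<theta> \<longleftrightarrow>
     continuous_on {0..} x \<and> \<theta> 0 = 0 \<and>
     (\<forall>t\<ge>0. (\<forall>s\<in>{0..t}. x s \<noteq> xs) \<longrightarrow>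
        (x has_vector_derivative
           - (\<theta> t / (norm (gradient f (x t)))\<^sup>2) *\<^sub>R gradient f (x t)) (at t within {0..}) \<and>
        (\<theta> has_real_derivative
           - lam * \<theta> t + \<rho> * (norm (gradient f (x t)))\<^sup>2) (at t within {0..}))"

text \<open>\<open>T\<close> is the first time at which \<open>x\<close> equals \<open>xs\<close>; there is no such \<open>T\<close> if \<open>xs\<close> is never reached.\<close>

definition is_convergence_time :: "(real \<Rightarrow> 'a) \<Rightarrow> 'a \<Rightarrow> real \<Rightarrow> bool" where
  "is_convergence_time x xs T \<longleftrightarrow> 0 \<le> T \<and> x T = xs \<and> (\<forall>t\<in>{0..<T}. x t \<noteq> xs)"

end

theory Submission
  imports Defs
begin

text \<open>The gap \<open>\<phi> t = f (x t) - f xs\<close> and \<open>\<theta>\<close> form a damped oscillator. The chain rule gives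
  \<open>\<phi>' = - \<theta>\<close>, the factor \<open>1 / \<parallel>\<nabla>f\<parallel>\<^sup>2\<close> being there to make this exact. Since \<open>\<nabla>f xs = 0\<close>, strong
  convexity bounds \<open>\<parallel>\<nabla>f x\<parallel>\<close> below by \<open>\<mu> \<parallel>x - xs\<parallel>\<close>, while the one-sided gradient bound gives
  \<open>f x - f xs \<le> L / 2 * \<parallel>x - xs\<parallel>\<^sup>2\<close>; together (lemma \<open>gap_le_gradient_norm\<close>)
  \<open>\<parallel>\<nabla>f x\<parallel>\<^sup>2 \<ge> (2 \<mu>\<^sup>2 / L) * (f x - f xs)\<close>. So, as long as the minimum point has not been met,
  \<open>\<phi>'' + lam * \<phi>' + k * \<phi> \<le> 0\<close> with \<open>k = 2 \<rho> \<mu>\<^sup>2 / L\<close>.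

  The hypothesis on \<open>lam\<close> says \<open>k > lam\<^sup>2 / 4\<close>: the oscillator is underdamped, with frequency
  \<open>\<omega> = sqrt (k - lam\<^sup>2 / 4)\<close>. A Sturm comparison with a solution of the adjoint equation that
  stays positive for half a period (lemma \<open>underdamped_half_period\<close>) shows that \<open>\<phi>\<close>
  cannot stay positive on \<open>[0, pi / \<omega>]\<close>. But \<open>\<phi>\<close> is positive away from \<open>xs\<close>, so \<open>x\<close> meets \<open>xs\<close>
  within that time; the first meeting exists because \<open>x\<close> is continuous.\<close>

section \<open>Gradients at and near a minimum point\<close>

lemma has_gradient_GDERIV:
  assumes "has_gradient f"
  shows "GDERIV f x :> gradient f x"
  using assms gradient_eqI unfolding has_gradient_def by metis

lemma GDERIV_compose_vector_derivative:
  assumes "GDERIV f (x t) :> D" and "(x has_vector_derivative v) (at t within S)"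
  shows "((\<lambda>t. f (x t)) has_real_derivative v \<bullet> D) (at t within S)"
proof -
  have f: "(f has_derivative (\<lambda>h. h \<bullet> D)) (at (x t) within x ` S)"
    using assms(1) unfolding gderiv_def by (rule has_derivative_at_withinI)
  have "((f \<circ> x) has_derivative ((\<lambda>h. h \<bullet> D) \<circ> (\<lambda>s. s *\<^sub>R v))) (at t within S)"
    using assms(2) f unfolding has_vector_derivative_def by (rule diff_chain_within)
  moreover have "(\<lambda>h. h \<bullet> D) \<circ> (\<lambda>s. s *\<^sub>R v) = (*) (v \<bullet> D)"
    by (simp add: fun_eq_iff mult.commute)
  ultimately show ?thesis by (simp add: has_field_derivative_def o_def)
qed

lemma gradient_eq_0_at_minimum:
  assumes "has_gradient f" and "\<forall>y. f z \<le> f y"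
  shows "gradient f z = 0"
proof -
  have "(f has_derivative (\<lambda>h. h \<bullet> gradient f z)) (at z)"
    using has_gradient_GDERIV[OF assms(1)] unfolding gderiv_def .
  then have "(\<lambda>h. h \<bullet> gradient f z) = (\<lambda>h. 0)"
    by (rule has_derivative_local_min) (simp add: assms(2))
  then have "gradient f z \<bullet> gradient f z = 0" by metis
  then show ?thesis by simp
qed

lemma strong_convex_gradient_lower_bound:
  assumes "strong_convex \<mu> f" and "gradient f z = 0"
  shows "\<mu> * norm (y - z) \<le> norm (gradient f y)"
proof (cases "y = z")
  case False
  have "\<mu> * (norm (y - z))\<^sup>2 \<le> (gradient f y - gradient f z) \<bullet> (y - z)"
    using assms(1) unfolding strong_convex_def by blast
  also have "\<dots> \<le> norm (gradient f y) * norm (y - z)"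
    using assms(2) by (simp add: norm_cauchy_schwarz)
  finally have "(\<mu> * norm (y - z)) * norm (y - z) \<le> norm (gradient f y) * norm (y - z)"
    by (simp add: power2_eq_square mult.assoc)
  then show ?thesis using False by (simp add: mult_le_cancel_right)
qed simp

text \<open>Along the segment from \<open>z\<close> to \<open>y\<close> the slope of \<open>f\<close> at parameter \<open>s\<close> is at most
  \<open>L * s * (norm (y - z))\<^sup>2\<close>, and this integrates to the factor \<open>L / 2\<close>. That slope is
  the component of the gradient along the segment, which is what the one-sided bound controls when
  the gradient is compared with its value \<open>0\<close> at \<open>z\<close>.\<close>

lemma gap_le_quadratic:
  assumes "L_continuous_gradient L f" and "gradient f z = 0"
  shows "f y - f z \<le> L / 2 * (norm (y - z))\<^sup>2"
proof -
  define d where "d = y - z"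
  define h where "h s = f (z + s *\<^sub>R d) - L / 2 * s\<^sup>2 * (norm d)\<^sup>2" for s
  have grad: "has_gradient f"
    using assms(1) unfolding L_continuous_gradient_def by blast
  have "\<exists>h'. (h has_real_derivative h') (at s) \<and> h' \<le> 0" if "0 \<le> s" for s
  proof -
    let ?g = "gradient f (z + s *\<^sub>R d)"
    have "((\<lambda>s. z + s *\<^sub>R d) has_vector_derivative d) (at s)"
      by (auto intro!: derivative_eq_intros)
    then have "((\<lambda>s. f (z + s *\<^sub>R d)) has_real_derivative d \<bullet> ?g) (at s)"
      by (rule GDERIV_compose_vector_derivative[OF has_gradient_GDERIV[OF grad]])
    then have deriv: "(h has_real_derivative d \<bullet> ?g - L * s * (norm d)\<^sup>2) (at s)"
      unfolding h_def by (auto intro!: derivative_eq_intros)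
    have "d \<bullet> ?g \<le> L * s * (norm d)\<^sup>2"
    proof (cases "s = 0")
      case False
      have "(?g - gradient f z) \<bullet> (z + s *\<^sub>R d - z) \<le> L * (norm (z + s *\<^sub>R d - z))\<^sup>2"
        using assms(1) unfolding L_continuous_gradient_def by blast
      then have "s * (d \<bullet> ?g) \<le> s * (L * s * (norm d)\<^sup>2)"
        using assms(2) by (simp add: inner_commute power_mult_distrib power2_eq_square mult_ac)
      then show ?thesis using False that by (simp add: mult_le_cancel_left)
    qed (simp add: assms(2))
    with deriv show ?thesis by (meson diff_le_0_iff_le)
  qed
  then have "h 1 \<le> h 0" using DERIV_nonpos_imp_nonincreasing[of 0 1 h] by simp
  then show ?thesis by (simp add: h_def d_def)
qed

lemma gap_le_gradient_norm:
  assumes "L_continuous_gradient L f" and "strong_convex \<mu> f" and "L > 0" and "\<mu> > 0"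
    and "gradient f z = 0"
  shows "2 * \<mu>\<^sup>2 / L * (f y - f z) \<le> (norm (gradient f y))\<^sup>2"
proof -
  have "2 * \<mu>\<^sup>2 / L * (f y - f z) \<le> 2 * \<mu>\<^sup>2 / L * (L / 2 * (norm (y - z))\<^sup>2)"
    using gap_le_quadratic[OF assms(1,5)] \<open>L > 0\<close> by (intro mult_left_mono) auto
  also have "\<dots> = (\<mu> * norm (y - z))\<^sup>2"
    using \<open>L > 0\<close> by (simp add: power_mult_distrib)
  also have "\<dots> \<le> (norm (gradient f y))\<^sup>2"
    using strong_convex_gradient_lower_bound[OF assms(2,5)] \<open>\<mu> > 0\<close> by (intro power_mono) auto
  finally show ?thesis .
qed

section \<open>Sturm comparison for an underdamped oscillator\<close>

text \<open>The comparison function \<open>\<psi> t = exp (lam * t / 2) * sin (\<omega> * t)\<close> solves the adjoint equation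
  \<open>\<psi>'' - lam * \<psi>' + k * \<psi> = 0\<close>, where \<open>k = \<omega>\<^sup>2 + lam\<^sup>2 / 4\<close>, and is nonnegative on \<open>[0, pi / \<omega>]\<close>.
  Hence the Wronskian-type quantity \<open>W = \<psi> * \<phi>' - \<psi>' * \<phi> + lam * \<psi> * \<phi>\<close> has derivative
  \<open>\<psi> * (\<phi>'' + lam * \<phi>' + k * \<phi>) \<le> 0\<close> there. As \<open>\<psi>\<close> vanishes at both ends, only \<open>- \<psi>' * \<phi>\<close>
  survives in \<open>W\<close> at the end points, and \<open>\<psi>'\<close> has opposite signs at the two ends.\<close>

lemma underdamped_half_period:
  fixes \<phi> \<theta> \<theta>' :: "real \<Rightarrow> real" and lam \<omega> :: real
  defines "T \<equiv> pi / \<omega>"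
  assumes "\<omega> > 0"
    and \<phi>: "\<And>t. t \<in> {0..T} \<Longrightarrow> (\<phi> has_real_derivative - \<theta> t) (at t within {0..T})"
    and \<theta>: "\<And>t. t \<in> {0..T} \<Longrightarrow> (\<theta> has_real_derivative \<theta>' t) (at t within {0..T})"
    and ineq: "\<And>t. t \<in> {0..T} \<Longrightarrow> (\<omega>\<^sup>2 + lam\<^sup>2 / 4) * \<phi> t \<le> \<theta>' t + lam * \<theta> t"
  shows "\<phi> 0 + exp (lam * T / 2) * \<phi> T \<le> 0"
proof -
  define E where "E t = exp (lam * t / 2)" for t
  define \<psi> where "\<psi> t = E t * sin (\<omega> * t)" for t
  define \<psi>' where "\<psi>' t = E t * (lam / 2 * sin (\<omega> * t) + \<omega> * cos (\<omega> * t))" for t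
  define W where "W t = - \<psi> t * \<theta> t - \<psi>' t * \<phi> t + lam * \<psi> t * \<phi> t" for t
  have E: "(E has_real_derivative lam / 2 * E t) (at t within S)" for t S
    unfolding E_def by (auto intro!: derivative_eq_intros)
  have \<psi>_deriv: "(\<psi> has_real_derivative \<psi>' t) (at t within S)" for t S
    unfolding \<psi>_def \<psi>'_def
    by (auto intro!: derivative_eq_intros E simp: algebra_simps)
  have \<psi>'_deriv:
    "(\<psi>' has_real_derivative lam * \<psi>' t - (\<omega>\<^sup>2 + lam\<^sup>2 / 4) * \<psi> t) (at t within S)" for t S
    unfolding \<psi>'_def \<psi>_def
    by (auto intro!: derivative_eq_intros E simp: field_simps power2_eq_square)
  have W_deriv: "(W has_real_derivative
      - (\<psi> t * (\<theta>' t + lam * \<theta> t - (\<omega>\<^sup>2 + lam\<^sup>2 / 4) * \<phi> t))) (at t within {0..T})"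
    if "t \<in> {0..T}" for t
    unfolding W_def
    by (rule \<psi>_deriv \<psi>'_deriv \<phi>[OF that] \<theta>[OF that] derivative_eq_intros refl)+
      (simp add: algebra_simps)
  have T: "T > 0" "\<omega> * T = pi"
    using \<open>\<omega> > 0\<close> by (simp_all add: T_def)
  have \<psi>_nonneg: "\<psi> t \<ge> 0" if "t \<in> {0..T}" for t
  proof -
    have "\<omega> * t \<le> \<omega> * T" using that \<open>\<omega> > 0\<close> by (intro mult_left_mono) auto
    then show ?thesis
      using that \<open>\<omega> > 0\<close> T by (auto simp: \<psi>_def E_def intro!: mult_nonneg_nonneg sin_ge_zero)
  qed
  have "W T \<le> W 0"
  proof (rule DERIV_nonpos_imp_decreasing_open[where f = W])
    show "continuous_on {0..T} W"
      using W_deriv by (rule DERIV_continuous_on)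
    fix t assume "0 < t" "t < T"
    then show "\<exists>y. (W has_real_derivative y) (at t) \<and> y \<le> 0"
      using W_deriv[of t] \<psi>_nonneg[of t] ineq[of t]
      by (intro exI[of _ "- (\<psi> t * (\<theta>' t + lam * \<theta> t - (\<omega>\<^sup>2 + lam\<^sup>2 / 4) * \<phi> t))"])
        (auto simp: at_within_Icc_at)
  qed (use T in simp)
  also have "W 0 = - \<omega> * \<phi> 0"
    by (simp add: W_def \<psi>_def \<psi>'_def E_def)
  also have "W T = \<omega> * (E T * \<phi> T)"
    using T by (simp add: W_def \<psi>_def \<psi>'_def)
  finally have "\<omega> * (\<phi> 0 + E T * \<phi> T) \<le> 0" by (simp add: algebra_simps)
  then show ?thesis using \<open>\<omega> > 0\<close> by (simp add: E_def mult_le_0_iff)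
qed

section \<open>Finite-time convergence\<close>

lemma first_meeting_time:
  fixes x :: "real \<Rightarrow> 'a::t1_space"
  assumes "continuous_on {0..} x" and "0 \<le> t" and "x t = z"
  obtains T where "is_convergence_time x z T" and "T \<le> t"
proof -
  define S where "S = {s \<in> {0..t}. x s = z}"
  have "continuous_on {0..t} x"
    using assms(1) by (rule continuous_on_subset) auto
  then have "closed S"
    unfolding S_def by (intro continuous_closed_preimage_constant) auto
  moreover have "bounded S" by (rule bounded_subset[of "{0..t}"]) (auto simp: S_def)
  ultimately have "compact S" by (simp add: compact_eq_bounded_closed)
  moreover have "t \<in> S" using assms by (simp add: S_def)
  ultimately obtain T where "T \<in> S" and T: "\<forall>s\<in>S. T \<le> s"
    using compact_attains_inf[of S] by blast
  then have "is_convergence_time x z T" and "T \<le> t"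
    unfolding is_convergence_time_def S_def by force+
  then show ?thesis using that by blast
qed

theorem theorem3:
  fixes f :: "real ^ 'n \<Rightarrow> real" and xs x0 :: "real ^ 'n"
    and L \<mu> lam \<rho> :: real
    and x :: "real \<Rightarrow> real ^ 'n" and \<theta> :: "real \<Rightarrow> real"
  assumes "convex_on UNIV f"
    and "\<forall>y. f xs \<le> f y"
    and "L > 0" and "L_continuous_gradient L f"
    and "\<mu> > 0" and "strong_convex \<mu> f"
    and "lam > 0" and "\<rho> > 0"
    and "lam\<^sup>2 < 8 * \<rho> * \<mu>\<^sup>2 / L"
    and "trajectory f xs lam \<rho> x \<theta>" and "x 0 = x0"
  shows "\<exists>T. is_convergence_time x xs T \<and>
             T \<le> pi / sqrt (2 * \<rho> * \<mu>\<^sup>2 / L - lam\<^sup>2 / 4)"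
proof -
  define \<omega> where "\<omega> = sqrt (2 * \<rho> * \<mu>\<^sup>2 / L - lam\<^sup>2 / 4)"
  define T where "T = pi / \<omega>"
  have "\<omega> > 0" using assms(9) by (simp add: \<omega>_def)
  then have "T > 0" by (simp add: T_def)
  have k: "\<omega>\<^sup>2 + lam\<^sup>2 / 4 = \<rho> * (2 * \<mu>\<^sup>2 / L)" using assms(9) by (simp add: \<omega>_def)
  have grad: "has_gradient f"
    using assms(4) unfolding L_continuous_gradient_def by blast
  have grad_xs: "gradient f xs = 0"
    using gradient_eq_0_at_minimum[OF grad assms(2)] .
  have grad_nonzero: "gradient f y \<noteq> 0" if "y \<noteq> xs" for y
    using strong_convex_gradient_lower_bound[OF assms(6) grad_xs, of y] that \<open>\<mu> > 0\<close>
    by (auto simp: mult_le_0_iff)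

  have "\<exists>t\<in>{0..T}. x t = xs"
  proof (rule ccontr)
    assume "\<not> ?thesis"
    then have away: "x t \<noteq> xs" if "t \<in> {0..T}" for t using that by blast
    define \<phi> where "\<phi> t = f (x t) - f xs" for t
    define \<theta>' where "\<theta>' t = - lam * \<theta> t + \<rho> * (norm (gradient f (x t)))\<^sup>2" for t
    have x_deriv: "(x has_vector_derivative
          - (\<theta> t / (norm (gradient f (x t)))\<^sup>2) *\<^sub>R gradient f (x t)) (at t within {0..T})"
      and \<theta>_deriv: "(\<theta> has_real_derivative \<theta>' t) (at t within {0..T})"
      if "t \<in> {0..T}" for t
    proof -
      have "t \<ge> 0" and "\<forall>s\<in>{0..t}. x s \<noteq> xs" using that away by auto
      then have "(x has_vector_derivative
            - (\<theta> t / (norm (gradient f (x t)))\<^sup>2) *\<^sub>R gradient f (x t)) (at t within {0..})"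
        and "(\<theta> has_real_derivative \<theta>' t) (at t within {0..})"
        using assms(10) unfolding trajectory_def \<theta>'_def by blast+
      moreover have "{0..T} \<subseteq> {0..}" by auto
      ultimately show "(x has_vector_derivative
            - (\<theta> t / (norm (gradient f (x t)))\<^sup>2) *\<^sub>R gradient f (x t)) (at t within {0..T})"
        and "(\<theta> has_real_derivative \<theta>' t) (at t within {0..T})"
        by (blast intro: has_vector_derivative_within_subset DERIV_subset)+
    qed
    have \<phi>_deriv: "(\<phi> has_real_derivative - \<theta> t) (at t within {0..T})" if t: "t \<in> {0..T}" for t
      using GDERIV_compose_vector_derivative[OF has_gradient_GDERIV[OF grad] x_deriv[OF t]]
        grad_nonzero[OF away[OF t]]
      unfolding \<phi>_def by (auto intro!: derivative_eq_intros simp: dot_square_norm)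
    have "(\<omega>\<^sup>2 + lam\<^sup>2 / 4) * \<phi> t \<le> \<theta>' t + lam * \<theta> t" for t
      using mult_left_mono[OF gap_le_gradient_norm[OF assms(4,6,3,5) grad_xs], of \<rho> "x t"] \<open>\<rho> > 0\<close>
      unfolding k \<phi>_def \<theta>'_def by (simp add: mult.assoc)
    then have "\<phi> 0 + exp (lam * T / 2) * \<phi> T \<le> 0"
      using underdamped_half_period[of \<omega> \<phi> \<theta> \<theta>' lam] \<open>\<omega> > 0\<close> \<phi>_deriv \<theta>_deriv
      unfolding T_def by blast
    moreover have "\<phi> T \<ge> 0" using assms(2) by (simp add: \<phi>_def)
    ultimately have "\<phi> 0 \<le> 0"
      by (smt (verit) exp_ge_zero mult_nonneg_nonneg)
    \<comment> \<open>The starting point then minimizes \<open>f\<close> too, but its gradient is nonzero.\<close>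
    then have "\<forall>y. f (x 0) \<le> f y" using assms(2) by (force simp: \<phi>_def intro: order_trans)
    then show False
      using gradient_eq_0_at_minimum[OF grad] grad_nonzero away[of 0] \<open>T > 0\<close> by auto
  qed
  then obtain t where t: "0 \<le> t" "t \<le> T" "x t = xs" by auto
  have "continuous_on {0..} x" using assms(10) unfolding trajectory_def by blast
  then obtain T' where "is_convergence_time x xs T'" "T' \<le> t"
    using t(1,3) by (rule first_meeting_time)
  with t(2) show ?thesis unfolding T_def \<omega>_def by (meson order_trans)
qed

end
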